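(* The complete list of permutation polynomials of $\mathbb{F}_{3^3}$ of the form \[ f(x)=x^6+a_5x^5+a_3x^3+a_2x^2+a_1x \qquad (a_1,a_2,a_3,a_5\in\mathbb{F}_{3^3}) \] with $a_5\neq 0$ is given by \[ x^6+ax^5+2a^4x^2, \qquad a\in\mathbb{F}_{3^3},\ a\neq 0. \]
   Context: A polynomial $f\in\mathbb{F}_q[x]$ is a permutation polynomial of $\mathbb{F}_q$ if $c\mapsto f(c)$ is a permutation of $\mathbb{F}_q$. *)

theory Defs
  imports "HOL-Computational_Algebra.Polynomial" "HOL-Library.Cardinality"
begin

definition permutation_poly :: "'a::{finite, field} poly \<Rightarrow> bool"
  where "permutation_poly f \<longleftrightarrow> bij (poly f)"

end

theory Submission
  imports Defs
begin

text \<open>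
  Substituting \<open>a\<^sub>5 x\<close> for \<open>x\<close> and dividing by \<open>a\<^sub>5\<^sup>6\<close> reduces everything to \<open>a\<^sub>5 = 1\<close>.

  If \<open>f\<close> is a permutation, then \<open>\<Sum>\<^sub>c f(c)\<^sup>n = 0\<close> for \<open>0 < n < 26\<close> (Hermite). The exponents
  \<open>n = 5\<close> and \<open>n = 7\<close> express \<open>a\<^sub>1, a\<^sub>2, a\<^sub>3\<close> through \<open>b = a\<^sub>1 + a\<^sub>2\<close>; then \<open>n = 8\<close> and \<open>n = 13\<close>
  give two polynomial equations for \<open>b\<close> whose only common root is \<open>-1\<close>.

  Conversely, let \<open>f = x\<^sup>6 + x\<^sup>5 - x\<^sup>2\<close> and suppose \<open>f(x) = f(y)\<close> with \<open>x \<noteq> y\<close>. With \<open>u = -(x + y)\<close>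
  and \<open>k = (1 - u)/(x - y)\<close>, the equation becomes quadratic in \<open>u\<close>, namely
  \<open>k\<^sup>2 u\<^sup>2 + (k\<^sup>4 - 1) u + 1 = 0\<close>. Its discriminant is \<open>m\<^sup>4 + m\<^sup>2 - m + 1\<close> for \<open>m = k\<^sup>2\<close>, and the
  13th power of this value is \<open>-1\<close>, so it is not a square.
\<close>

section \<open>Power sums over a finite field\<close>

lemma finite_field_power_card_minus_1:
  fixes x :: "'a::{finite, field}"
  assumes "x \<noteq> 0"
  shows "x ^ (CARD('a) - 1) = 1"
proof -
  have "(\<Prod>y\<in>UNIV-{0}. y) = (\<Prod>y\<in>UNIV-{0}. x * y)"
    by (rule prod.reindex_bij_witness[of _ "\<lambda>y. x * y" "\<lambda>y. y / x"]) (use assms in auto)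
  also have "\<dots> = x ^ (CARD('a) - 1) * (\<Prod>y\<in>UNIV-{0}. y)"
    by (simp add: prod.distrib)
  finally show ?thesis
    by simp
qed

lemma of_nat_card_eq_0: "of_nat (CARD('a)) = (0 :: 'a::{finite, field})"
proof -
  have "(\<Sum>x\<in>UNIV. x) = (\<Sum>x\<in>UNIV. x + 1 :: 'a)"
    by (rule sum.reindex_bij_witness[of _ "\<lambda>x. x + 1" "\<lambda>x. x - 1"]) auto
  then show ?thesis
    by (simp add: sum.distrib)
qed

text \<open>Scaling the summation variable by a nonzero \<open>g\<close> multiplies the sum by
  \<open>g ^ n\<close>, so one \<open>g\<close> with \<open>g ^ n \<noteq> 1\<close> forces it to
  vanish. For \<open>n = 0\<close> the convention \<open>0 ^ 0 = 1\<close> makes the sum the field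
  size, which is 0.\<close>

lemma sum_power_finite_field:
  "(\<Sum>c\<in>UNIV. c ^ n) = (if n > 0 \<and> CARD('a) - 1 dvd n then -1 else (0 :: 'a::{finite, field}))"
proof -
  define q where "q = CARD('a) - 1"
  have q: "CARD('a) = Suc q"
    by (simp add: q_def)
  have one: "x ^ q = 1" if "x \<noteq> 0" for x :: 'a
    unfolding q_def by (rule finite_field_power_card_minus_1[OF that])
  have card: "of_nat q + 1 = (0 :: 'a)"
    using of_nat_card_eq_0[where ?'a = 'a] by (simp add: q add.commute)
  show ?thesis
  proof (cases "q dvd n")
    case True
    then obtain k where k: "n = q * k" ..
    show ?thesis
    proof (cases "n = 0")
      case True
      then show ?thesis
        by (simp add: of_nat_card_eq_0)
    next
      case False
      have "(\<Sum>c\<in>UNIV. c ^ n) = (\<Sum>c\<in>UNIV - {0}. c ^ n :: 'a)"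
        using False by (intro sum.mono_neutral_right) auto
      also have "\<dots> = (\<Sum>c\<in>UNIV - {0::'a}. 1)"
        by (intro sum.cong) (auto simp: k power_mult one)
      also have "\<dots> = -1"
        using card by (simp add: q eq_neg_iff_add_eq_0)
      finally show ?thesis
        using False \<open>q dvd n\<close> by (simp add: q_def)
    qed
  next
    case False
    have q_pos: "q > 0"
      using card by (cases q) auto
    define r where "r = n mod q"
    have r: "0 < r" "r < q"
      using False q_pos by (auto simp: r_def mod_greater_zero_iff_not_dvd)
    have pow: "x ^ n = x ^ r" if "x \<noteq> 0" for x :: 'a
    proof -
      have "x ^ n = (x ^ q) ^ (n div q) * x ^ r"
        unfolding r_def by (simp flip: power_mult power_add)
      then show ?thesis
        by (simp add: one that)
    qed
    \<comment> \<open>Otherwise \<open>monom 1 r - 1\<close>, of degree at most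
      \<open>r < q\<close>, would have all \<open>q\<close> nonzero elements as roots.\<close>
    have "\<exists>g::'a. g \<noteq> 0 \<and> g ^ n \<noteq> 1"
    proof (rule ccontr)
      assume "\<not> ?thesis"
      then have root: "g ^ r = 1" if "g \<noteq> 0" for g :: 'a
        using pow that by metis
      define p :: "'a poly" where "p = monom 1 r - 1"
      have "coeff p r = 1"
        using r by (simp add: p_def)
      then have "p \<noteq> 0"
        by auto
      have "q = card (UNIV - {0::'a})"
        by (simp add: q)
      also have "\<dots> \<le> card {x. poly p x = 0}"
        by (rule card_mono) (auto simp: p_def poly_monom root)
      also have "\<dots> \<le> degree p"
        by (rule card_poly_roots_bound) fact
      also have "\<dots> \<le> r"
        unfolding p_def by (rule degree_diff_le) (auto simp: degree_monom_le)
      finally show False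
        using r by simp
    qed
    then obtain g :: 'a where g: "g \<noteq> 0" "g ^ n \<noteq> 1"
      by auto
    have "(\<Sum>c\<in>UNIV. c ^ n) = (\<Sum>c\<in>UNIV. (g * c) ^ n)"
      by (rule sum.reindex_bij_witness[of _ "\<lambda>y. g * y" "\<lambda>y. y / g"]) (use g in auto)
    also have "\<dots> = g ^ n * (\<Sum>c\<in>UNIV. c ^ n)"
      by (simp add: power_mult_distrib sum_distrib_left)
    finally have "(\<Sum>c\<in>UNIV. c ^ n) = (0 :: 'a)"
      using g by simp
    then show ?thesis
      using False by (simp add: q_def)
  qed
qed

section \<open>Term lists for computing power sums\<close>

text \<open>Exponents may repeat and need no order, so products require no collection of like terms
  and concrete lists simply unfold.\<close>

definition sparse_eval :: "('a::comm_semiring_1 \<times> nat) list \<Rightarrow> 'a \<Rightarrow> 'a"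
  where "sparse_eval ts x = (\<Sum>(a, n)\<leftarrow>ts. a * x ^ n)"

definition sparse_mult ::
    "('a::comm_semiring_1 \<times> nat) list \<Rightarrow> ('a \<times> nat) list \<Rightarrow> ('a \<times> nat) list"
  where "sparse_mult ss ts = concat (map (\<lambda>(a, m). map (\<lambda>(b, n). (a * b, m + n)) ts) ss)"

text \<open>Represents the \<open>q\<close>-th power only where \<open>q\<close>-th powers are
  additive; the number of terms then does not grow.\<close>

definition sparse_frob ::
    "nat \<Rightarrow> ('a::comm_semiring_1 \<times> nat) list \<Rightarrow> ('a \<times> nat) list"
  where "sparse_frob q ts = map (\<lambda>(a, n). (a ^ q, q * n)) ts"

lemma sparse_eval_append: "sparse_eval (ss @ ts) x = sparse_eval ss x + sparse_eval ts x"
  by (simp add: sparse_eval_def)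

lemma sparse_eval_mult: "sparse_eval (sparse_mult ss ts) x = sparse_eval ss x * sparse_eval ts x"
proof (induction ss)
  case (Cons s ss)
  obtain a m where s: "s = (a, m)"
    by fastforce
  have "sparse_eval (map (\<lambda>(b, n). (a * b, m + n)) ts) x = a * x ^ m * sparse_eval ts x"
    by (induction ts) (auto simp: sparse_eval_def algebra_simps power_add)
  with Cons show ?case
    by (simp add: s sparse_mult_def sparse_eval_append) (simp add: sparse_eval_def algebra_simps)
qed (simp add: sparse_eval_def sparse_mult_def)

lemma sparse_eval_frob:
  assumes add: "\<And>x y :: 'a::comm_semiring_1. (x + y) ^ q = x ^ q + y ^ q" and "q > 0"
  shows "sparse_eval (sparse_frob q ts) x = sparse_eval ts (x :: 'a) ^ q"
  using \<open>q > 0\<close>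
  by (induction ts)
     (auto simp: sparse_eval_def sparse_frob_def add power_mult_distrib power_0_left
           simp flip: power_mult, simp add: mult.commute)

text \<open>Only terms whose exponent is a positive multiple of the group order survive summation,
  each contributing minus its coefficient. A vanishing power sum thus becomes an equation in the
  coefficients.\<close>

lemma sum_sparse_eval:
  "(\<Sum>c\<in>UNIV. sparse_eval ts c) =
     - (\<Sum>(a, n)\<leftarrow>ts. if n > 0 \<and> CARD('a) - 1 dvd n then a else (0 :: 'a::{finite, field}))"
proof (induction ts)
  case (Cons t ts)
  obtain a n where t: "t = (a, n)"
    by fastforce
  have "(\<Sum>c\<in>UNIV. sparse_eval (t # ts) c)
      = a * (\<Sum>c\<in>UNIV. c ^ n) + (\<Sum>c\<in>UNIV. sparse_eval ts c)"
    by (simp add: t sparse_eval_def sum.distrib sum_distrib_left)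
  with Cons show ?case
    by (simp add: t sum_power_finite_field)
qed (simp add: sparse_eval_def)

section \<open>Arithmetic in characteristic 3\<close>

lemma three_eq_0:
  assumes "CARD('a::{finite, field}) = 3 ^ 3"
  shows "(3 :: 'a) = 0"
proof -
  have "(3 :: 'a) ^ 3 = 0"
    using of_nat_card_eq_0[where ?'a = 'a] unfolding assms by simp
  then show ?thesis
    unfolding power_eq_0_iff by simp
qed

lemma cube_add:
  fixes x y :: "'a::comm_ring_1"
  assumes "(3 :: 'a) = 0"
  shows "(x + y) ^ 3 = x ^ 3 + y ^ 3"
proof -
  have "(x + y) ^ 3 = x ^ 3 + y ^ 3 + 3 * (x\<^sup>2 * y + x * y\<^sup>2)"
    by (simp add: algebra_simps power2_eq_square power3_eq_cube)
  then show ?thesis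
    by (simp add: assms)
qed

section \<open>Necessity: solving the Hermite conditions\<close>

lemma sextic_bij_imp_coeffs:
  fixes a\<^sub>1 a\<^sub>2 a\<^sub>3 :: "'a::{finite, field}"
  assumes card: "CARD('a) = 3 ^ 3"
    and bij: "bij (\<lambda>x. x ^ 6 + x ^ 5 + a\<^sub>3 * x ^ 3 + a\<^sub>2 * x ^ 2 + a\<^sub>1 * x)"
  shows "a\<^sub>3 = 0 \<and> a\<^sub>2 = -1 \<and> a\<^sub>1 = 0"
proof -
  define ts where "ts = [(1, 6), (1, 5), (a\<^sub>3, 3), (a\<^sub>2, 2), (a\<^sub>1, 1::nat)]"
  have three: "(3 :: 'a) = 0"
    by (rule three_eq_0[OF card])
  have frob3: "(x + y) ^ 3 = x ^ 3 + y ^ 3" for x y :: 'a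
    by (rule cube_add[OF three])
  have frob9: "(x + y) ^ 9 = x ^ 9 + y ^ 9" for x y :: 'a
  proof -
    have "((x + y) ^ 3) ^ 3 = (x ^ 3) ^ 3 + (y ^ 3) ^ 3"
      by (simp only: frob3)
    then show ?thesis
      by (simp flip: power_mult)
  qed
  have vanish: "(\<Sum>c\<in>UNIV. sparse_eval ts c ^ n) = 0" if "0 < n" "n < 26" for n
  proof -
    have "sparse_eval ts = (\<lambda>x. x ^ 6 + x ^ 5 + a\<^sub>3 * x ^ 3 + a\<^sub>2 * x ^ 2 + a\<^sub>1 * x)"
      by (simp add: ts_def sparse_eval_def add.assoc fun_eq_iff)
    with bij have "bij (sparse_eval ts)"
      by simp
    then have "(\<Sum>c\<in>UNIV. sparse_eval ts c ^ n) = (\<Sum>c\<in>UNIV. c ^ n)"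
      by (rule sum.reindex_bij_betw)
    then show ?thesis
      using that by (auto simp: sum_power_finite_field card dest: dvd_imp_le)
  qed
  have cond: "(\<Sum>(a, n)\<leftarrow>ss. if n > 0 \<and> 26 dvd n then a else 0) = 0"
    if "\<And>x. sparse_eval ss x = sparse_eval ts x ^ n" "0 < n" "n < 26" for ss n
    using sum_sparse_eval[of ss] vanish[OF that(2,3)] that(1) by (simp add: card)
  have f3: "sparse_eval (sparse_frob 3 ts) x = sparse_eval ts x ^ 3" for x
    by (rule sparse_eval_frob) (auto simp: frob3)
  have f9: "sparse_eval (sparse_frob 9 ts) x = sparse_eval ts x ^ 9" for x
    by (rule sparse_eval_frob) (auto simp: frob9)
  \<comment> \<open>The exponents are split in base 3, here 5 = 2 + 3 and below 7 = 1 + 2*3, 8 = 2 +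
    2*3, 13 = 1 + 3 + 9, so that Frobenius keeps the lists short.\<close>
  have "sparse_eval (sparse_mult (sparse_mult ts ts) (sparse_frob 3 ts)) x
      = sparse_eval ts x ^ 5" for x
    by (simp add: sparse_eval_mult f3) algebra
  from cond[OF this] have 5: "2 + 2 * (a\<^sub>2 + a\<^sub>3) = 0"
    by (simp add: ts_def sparse_mult_def sparse_frob_def)
  have "sparse_eval (sparse_mult ts (sparse_frob 3 (sparse_mult ts ts))) x
      = sparse_eval ts x ^ 7" for x
    by (simp add: sparse_eval_mult sparse_eval_frob[OF frob3]) algebra
  from cond[OF this] have 7: "2 * (a\<^sub>2 + a\<^sub>3)^3 * a\<^sub>2 + 2 * (a\<^sub>1 + a\<^sub>2)^3 = 0"
    by (simp add: ts_def sparse_mult_def sparse_frob_def frob3 algebra_simps)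
  have "sparse_eval (sparse_mult (sparse_mult ts ts)
      (sparse_mult (sparse_frob 3 ts) (sparse_frob 3 ts))) x = sparse_eval ts x ^ 8" for x
    by (simp add: sparse_eval_mult f3) algebra
  from cond[OF this] have 8: "4 * (a\<^sub>2 ^ 3 * a\<^sub>3 ^ 3) + 4 * (a\<^sub>2 * a\<^sub>1 ^ 3) + 2 * (a\<^sub>2 * (a\<^sub>3 ^ 3)\<^sup>2)
      + 4 * (a\<^sub>3 * a\<^sub>1 ^ 3) + 2 * (a\<^sub>3 * (a\<^sub>3 ^ 3)\<^sup>2) + 4 * (a\<^sub>2 * a\<^sub>3 * a\<^sub>1 ^ 3)
      + 4 * (a\<^sub>2 * a\<^sub>3 * a\<^sub>2 ^ 3) + 2 * (a\<^sub>1 * a\<^sub>1 * a\<^sub>2 ^ 3) + 2 * (a\<^sub>1 * a\<^sub>1 * a\<^sub>3 ^ 3) = 0"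
    by (simp add: ts_def sparse_mult_def sparse_frob_def algebra_simps)
  have "sparse_eval (sparse_mult ts (sparse_mult (sparse_frob 3 ts) (sparse_frob 9 ts))) x
      = sparse_eval ts x ^ 13" for x
    by (simp add: sparse_eval_mult f3 f9) algebra
  from cond[OF this] have 13: "1 + a\<^sub>1 ^ 3 * a\<^sub>2 ^ 9 + a\<^sub>2 * a\<^sub>1 ^ 9 + a\<^sub>2 * (a\<^sub>2 ^ 3 * a\<^sub>2 ^ 9) + a\<^sub>1 * a\<^sub>2 ^ 3 = 0"
    by (simp add: ts_def sparse_mult_def sparse_frob_def algebra_simps)

  define b where "b = a\<^sub>1 + a\<^sub>2"
  have two: "2 = (-1 :: 'a)"
    using three by (simp add: eq_neg_iff_add_eq_0)
  have a23: "a\<^sub>2 + a\<^sub>3 = -1"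
    using 5 unfolding two by algebra
  have a2: "a\<^sub>2 = b ^ 3"
    using 7 unfolding two a23 by (simp add: b_def)
  have a1: "a\<^sub>1 = b - b ^ 3"
    using a2 by (simp add: b_def)
  have a3: "a\<^sub>3 = -1 - b ^ 3"
    using a23 a2 by (simp add: algebra_simps)
  have frob3_diff: "(x - y) ^ 3 = x ^ 3 - y ^ 3" for x y :: 'a
    using frob3[of x "- y"] by simp
  \<comment> \<open>This turns the ninth powers of the coefficients into low-degree polynomials in
    \<open>b\<close>; the condition for 13 then collapses to \<open>b ^ 13 + 1 = 0\<close>.\<close>
  have b27: "b ^ 27 = b"
    using finite_field_power_card_minus_1[of b]
    by (cases "b = 0") (simp_all add: card power_numeral_reduce)
  have a2_3: "a\<^sub>2 ^ 3 = b ^ 9" and a1_3: "a\<^sub>1 ^ 3 = b ^ 3 - b ^ 9" and a3_3: "a\<^sub>3 ^ 3 = -1 - b ^ 9"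
    by (simp_all add: a2 a1 a3 frob3_diff flip: power_mult)
  have a2_9: "a\<^sub>2 ^ 9 = b" and a1_9: "a\<^sub>1 ^ 9 = b ^ 9 - b"
    using arg_cong[OF a2_3, of "\<lambda>x. x ^ 3"] arg_cong[OF a1_3, of "\<lambda>x. x ^ 3"]
    by (simp_all add: frob3_diff b27 flip: power_mult)
  have b13: "b ^ 13 + 1 = 0"
    using 13 unfolding a2_3 a1_3 a2_9 a1_9 unfolding a2 a1 by algebra
  \<comment> \<open>The condition for 8, written in \<open>b\<close> and reduced modulo 3; the
    multiples of 3 are collected in the next line.\<close>
  define h where "h = b ^ 9 + b ^ 4 - b ^ 3 + b ^ 2 + 1"
  have "h + 3 * (- 2 * b ^ 18 - 3 * b ^ 9 - 2 * b ^ 6 + b ^ 4 - b ^ 3 - b ^ 2 - 1) = 0"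
    using 8 unfolding a2_3 a1_3 a3_3 h_def unfolding a2 a1 a3 by algebra
  then have "h = 0"
    by (simp add: three)
  moreover \<comment> \<open>Bezout relation modulo 3 between the two equations for \<open>b\<close>\<close>
  have "b + 1 + 3 * (b ^ 10 - b ^ 7)
      = h * (b ^ 11 + b ^ 10 - b ^ 7 - b ^ 3 + b + 1)
        + (b ^ 13 + 1) * (b ^ 3 - b ^ 2 - b ^ 6 - b ^ 7)"
    unfolding h_def by algebra
  ultimately have "b + 1 = 0"
    by (simp add: three b13)
  then have "b = -1"
    by (simp add: eq_neg_iff_add_eq_0)
  then show ?thesis
    by (simp add: a1 a2 a3)
qed

section \<open>Sufficiency: excluding collisions\<close>

text \<open>Euler's criterion: since 26 = 2 * 13, a nonzero square has 13th power 1, and 1 differs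
  from -1.\<close>

lemma quartic_nonsquare:
  fixes m s :: "'a::{finite, field}"
  assumes card: "CARD('a) = 3 ^ 3" and m: "m ^ 13 = 1"
  shows "s\<^sup>2 \<noteq> m ^ 4 + m\<^sup>2 - m + 1"
proof
  define P where "P = m ^ 4 + m\<^sup>2 - m + 1"
  assume s: "s\<^sup>2 = m ^ 4 + m\<^sup>2 - m + 1"
  have three: "(3 :: 'a) = 0"
    by (rule three_eq_0[OF card])
  have P3: "P ^ 3 = m ^ 12 + m ^ 6 - m ^ 3 + 1"
  proof -
    have "P ^ 3 = m ^ 12 + m ^ 6 - m ^ 3 + 1 + 3 * (m ^ 10 - m ^ 9 + 2 * m ^ 8 - 2 * m ^ 7
        + 3 * m ^ 6 - 3 * m ^ 5 + 3 * m ^ 4 - 2 * m ^ 3 + 2 * m ^ 2 - m)"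
      unfolding P_def by algebra
    then show ?thesis
      by (simp add: three)
  qed
  have P9: "P ^ 9 = m ^ 10 - m ^ 9 + m ^ 5 + 1"
  proof -
    have "P ^ 9 = (m ^ 12 + m ^ 6 + (- (m ^ 3)) + 1) ^ 3"
      by (simp flip: P3 power_mult)
    also have "\<dots> = m ^ 13 * m ^ 13 * m ^ 10 + m ^ 13 * m ^ 5 - m ^ 9 + 1"
      unfolding cube_add[OF three] by (simp flip: power_mult power_add)
    finally show ?thesis
      by (simp add: m)
  qed
  \<comment> \<open>The norm to the prime field, a product of three Frobenius conjugates.\<close>
  have "P ^ 13 = P * P ^ 3 * P ^ 9"
    by (simp flip: power_Suc power_add)
  also have "\<dots> = -1"
    unfolding P3 P9 unfolding P_def
  proof -
    \<comment> \<open>An integer identity exhibiting the product as -1 modulo 3 and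
      \<open>m ^ 13 - 1\<close>.\<close>
    have "(m ^ 4 + m\<^sup>2 - m + 1) * (m ^ 12 + m ^ 6 - m ^ 3 + 1) * (m ^ 10 - m ^ 9 + m ^ 5 + 1)
      = -1 + 3 * (m ^ 9 + m ^ 3 + m) + (m ^ 13 - 1) * (m ^ 13 - m ^ 12 + m ^ 11 - 2 * m ^ 10
        + 2 * m ^ 9 + m ^ 7 - 2 * m ^ 4 + 4 * m ^ 3 - m ^ 2 + 4 * m - 2)"
      by algebra
    then show "(m ^ 4 + m\<^sup>2 - m + 1) * (m ^ 12 + m ^ 6 - m ^ 3 + 1) * (m ^ 10 - m ^ 9 + m ^ 5 + 1)
      = -1"
      by (simp add: three m)
  qed
  finally have "(s\<^sup>2) ^ 13 = -1"
    using s by (simp only: P_def)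
  then have "s ^ 26 = -1"
    by (simp flip: power_mult)
  moreover have "s ^ 26 = 1" if "s \<noteq> 0"
    using finite_field_power_card_minus_1[OF that] by (simp add: card)
  moreover have "(1 :: 'a) \<noteq> -1"
  proof
    assume "(1 :: 'a) = -1"
    then have "(2 :: 'a) = 0"
      by (simp add: eq_neg_iff_add_eq_0)
    with three have "(3 - 2 :: 'a) = 0"
      by (simp only: diff_zero)
    then show False
      by simp
  qed
  ultimately show False
    by (cases "s = 0") auto
qed

text \<open>Writing the cofactor of \<open>x - y\<close> in terms of \<open>x - y\<close> and
  \<open>x + y\<close> prepares the substitution by \<open>d\<close>, \<open>v\<close> and
  \<open>u\<close>; the two sides differ by an explicit multiple of 3.\<close>

lemma collision_identity:
  fixes x y :: "'a::idom"
  assumes "(3 :: 'a) = 0"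
  shows "(x ^ 6 + x ^ 5 - x ^ 2) - (y ^ 6 + y ^ 5 - y ^ 2) =
    (x - y) * ((x - y) ^ 4 + (1 + x + y) * (x + y)^2 * (x - y)^2 - (1 + x + y) ^ 3 * (x + y))"
    (is "?lhs = ?rhs")
proof -
  have "?rhs = ?lhs + 3 * (-(x ^ 4 * y ^ 2) + x ^ 2 * y ^ 4 - 3 * x ^ 4 * y + 2 * x ^ 3 * y ^ 2
      - 2 * x ^ 2 * y ^ 3 + 3 * x * y ^ 4 - x ^ 4 - 2 * x ^ 3 * y + 2 * x * y ^ 3 + y ^ 4
      - x ^ 3 - x ^ 2 * y + x * y ^ 2 + y ^ 3)"
    by algebra
  then show ?thesis
    by (simp add: assms)
qed

lemma sextic_bij:
  assumes card: "CARD('a::{finite, field}) = 3 ^ 3"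
  shows "bij (\<lambda>x :: 'a. x ^ 6 + x ^ 5 - x ^ 2)"
proof -
  have three: "(3 :: 'a) = 0"
    by (rule three_eq_0[OF card])
  have "inj (\<lambda>x :: 'a. x ^ 6 + x ^ 5 - x ^ 2)"
  proof (rule injI, rule ccontr)
    fix x y :: 'a
    assume eq: "x ^ 6 + x ^ 5 - x ^ 2 = y ^ 6 + y ^ 5 - y ^ 2" and "x \<noteq> y"
    define d v where "d = x - y" and "v = 1 + x + y"
    define u k where "u = 1 - v" and "k = v / d"
    have d: "d \<noteq> 0"
      using \<open>x \<noteq> y\<close> by (simp add: d_def)
    have "d * (d ^ 4 + v * u\<^sup>2 * d\<^sup>2 + v ^ 3 * u)
        = (x ^ 6 + x ^ 5 - x ^ 2) - (y ^ 6 + y ^ 5 - y ^ 2)"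
      unfolding collision_identity[OF three] u_def d_def v_def by algebra
    with d eq have collision: "d ^ 4 + v * u\<^sup>2 * d\<^sup>2 + v ^ 3 * u = 0"
      by simp
    have "v \<noteq> 0"
      using collision d by auto
    have v: "v = k * d"
      using d by (simp add: k_def)
    have "k \<noteq> 0"
      using \<open>v \<noteq> 0\<close> by (auto simp: v)
    \<comment> \<open>After multiplication by \<open>v\<close>, the substitution
      \<open>v = k * d\<close> in the two later terms exposes a factor \<open>d ^ 4\<close>; the
      factor \<open>v\<close> left in the first term is \<open>1 - u\<close>.\<close>
    have "d ^ 4 * (k\<^sup>2 * u\<^sup>2 + (k ^ 4 - 1) * u + 1) = v * (d ^ 4 + v * u\<^sup>2 * d\<^sup>2 + v ^ 3 * u)"
      unfolding u_def v by algebra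
    with collision d have quadratic: "k\<^sup>2 * u\<^sup>2 + (k ^ 4 - 1) * u + 1 = 0"
      by simp
    have "(k\<^sup>2) ^ 13 = 1"
      using finite_field_power_card_minus_1[OF \<open>k \<noteq> 0\<close>] by (simp add: card flip: power_mult)
    \<comment> \<open>Completing the square gives the discriminant
      \<open>(k ^ 4 - 1)\<^sup>2 - 4 * k\<^sup>2\<close>, which is the quartic at
      \<open>m = k\<^sup>2\<close> modulo 3.\<close>
    moreover have "(2 * k\<^sup>2 * u + k ^ 4 - 1)\<^sup>2 = (k\<^sup>2) ^ 4 + (k\<^sup>2)\<^sup>2 - k\<^sup>2 + 1"
    proof -
      have "(2 * k\<^sup>2 * u + k ^ 4 - 1)\<^sup>2 = (k\<^sup>2) ^ 4 + (k\<^sup>2)\<^sup>2 - k\<^sup>2 + 1 - 3 * (k ^ 4 + k\<^sup>2)"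
        using quadratic by algebra
      then show ?thesis
        by (simp add: three)
    qed
    ultimately show False
      using quartic_nonsquare[OF card] by blast
  qed
  then show ?thesis
    by (simp add: bij_def finite_UNIV_inj_surj)
qed

section \<open>Normalization of the quintic coefficient and classification\<close>

lemma sextic_bij_iff:
  fixes a b c :: "'a::{finite, field}"
  assumes card: "CARD('a) = 3 ^ 3"
  shows "bij (\<lambda>x. x ^ 6 + x ^ 5 + a * x ^ 3 + b * x ^ 2 + c * x) \<longleftrightarrow> a = 0 \<and> b = -1 \<and> c = 0"
proof
  assume "a = 0 \<and> b = -1 \<and> c = 0"
  then show "bij (\<lambda>x. x ^ 6 + x ^ 5 + a * x ^ 3 + b * x ^ 2 + c * x)"
    using sextic_bij[OF card] by simp
qed (rule sextic_bij_imp_coeffs[OF card])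

lemma permutation_poly_sextic_iff:
  fixes a b c e :: "'a::{finite, field}"
  assumes "a \<noteq> 0"
  shows "permutation_poly (monom 1 6 + monom a 5 + monom b 3 + monom c 2 + monom e 1) \<longleftrightarrow>
    bij (\<lambda>x. x ^ 6 + x ^ 5 + (b / a ^ 3) * x ^ 3 + (c / a ^ 4) * x ^ 2 + (e / a ^ 5) * x)"
    (is "permutation_poly ?f \<longleftrightarrow> bij ?g")
proof -
  have scale: "bij (\<lambda>x :: 'a. s * x)" if "s \<noteq> 0" for s
    by (rule bij_betw_byWitness[where f' = "\<lambda>x. x / s"]) (use that in auto)
  \<comment> \<open>\<open>?f\<close> at \<open>x\<close> is \<open>a ^ 6\<close> times
    \<open>?g\<close> at \<open>x / a\<close>: the two maps differ by invertible scalings on both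
    sides.\<close>
  have f: "poly ?f = (\<lambda>x. a ^ 6 * x) \<circ> ?g \<circ> (\<lambda>x. 1 / a * x)"
    using assms by (auto simp: fun_eq_iff poly_monom field_simps power_numeral_reduce)
  have g: "?g = (\<lambda>x. 1 / a ^ 6 * x) \<circ> poly ?f \<circ> (\<lambda>x. a * x)"
    using assms by (auto simp: fun_eq_iff poly_monom field_simps power_numeral_reduce)
  show ?thesis
    unfolding permutation_poly_def
  proof
    assume "bij (poly ?f)"
    then show "bij ?g"
      unfolding g by (intro bij_comp scale) (use assms in auto)
  next
    assume "bij ?g"
    then show "bij (poly ?f)"
      unfolding f by (intro bij_comp scale) (use assms in auto)
  qed
qed

lemma permutation_poly_sextic_27_iff:
  fixes a b c e :: "'a::{finite, field}"
  assumes card: "CARD('a) = 3 ^ 3" and "a \<noteq> 0"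
  shows "permutation_poly (monom 1 6 + monom a 5 + monom b 3 + monom c 2 + monom e 1) \<longleftrightarrow>
    b = 0 \<and> c = 2 * a ^ 4 \<and> e = 0"
proof -
  have "2 = (-1 :: 'a)"
    using three_eq_0[OF card] by (simp add: eq_neg_iff_add_eq_0)
  then have "b = 0 \<and> c = 2 * a ^ 4 \<and> e = 0 \<longleftrightarrow>
      b / a ^ 3 = 0 \<and> c / a ^ 4 = -1 \<and> e / a ^ 5 = 0"
    using assms by (auto simp: field_simps)
  then show ?thesis
    unfolding permutation_poly_sextic_iff[OF \<open>a \<noteq> 0\<close>] sextic_bij_iff[OF card] by simp
qed

theorem theorem3p16:
  assumes "CARD('a::{finite, field}) = 3 ^ 3"
  shows "{f :: 'a poly. permutation_poly f \<and>
            (\<exists>a\<^sub>5 a\<^sub>3 a\<^sub>2 a\<^sub>1. a\<^sub>5 \<noteq> 0 \<and>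
               f = monom 1 6 + monom a\<^sub>5 5 + monom a\<^sub>3 3 + monom a\<^sub>2 2 + monom a\<^sub>1 1)}
         = {monom 1 6 + monom a 5 + monom (2 * a ^ 4) 2 | a :: 'a. a \<noteq> 0}"
    (is "?L = ?R")
proof (intro Set.equalityI subsetI)
  fix f
  assume "f \<in> ?L"
  then show "f \<in> ?R"
    using permutation_poly_sextic_27_iff[OF assms] by fastforce
next
  fix f
  assume "f \<in> ?R"
  then obtain a :: 'a where a: "a \<noteq> 0" "f = monom 1 6 + monom a 5 + monom (2 * a ^ 4) 2"
    by auto
  have f: "f = monom 1 6 + monom a 5 + monom 0 3 + monom (2 * a ^ 4) 2 + monom 0 1"
    using a by simp
  moreover have "permutation_poly f"
    unfolding f permutation_poly_sextic_27_iff[OF assms \<open>a \<noteq> 0\<close>] by simp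
  ultimately show "f \<in> ?L"
    using a(1) by blast
qed

end
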